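(* Let $i\ge 2$ and let $B_{2i}$ be a bouquet with $2i$ edges whose intersection graph $I(B_{2i})$ is the complete bipartite graph $K_{i,i}$. Then $$^{\partial}\varepsilon_{B_{2i}}^{\times}(z)=\begin{cases} z^{2i-1}+2\left[(1+z)^{i}-z^i\right]z^{i+1}+z^2\left[(1+z)^{i}-z^i\right]^2, & \text{if } i \text{ is odd},\\ z^{2i}+2\left[(1+z)^{i}-z^i\right]z^{i}+z^2\left[(1+z)^{i}-z^i\right]^2, & \text{if } i \text{ is even}.\end{cases}$$
   Context: A ribbon graph $G$ is a surface with boundary represented as the union of two finite sets of closed topological discs, vertex-discs $V(G)$ and edge-ribbons $E(G)$, such that: vertex-discs and edge-ribbons intersect in disjoint line segments; each such segment lies on the boundary of precisely one vertex-disc and precisely one edge-ribbon; every edge-ribbon contains exactly two such segments. All graphs are connected (loops and multiple edges allowed). Let $F(G)$ be the set of faces (boundary components of the surface) and $c(G)$ the number of connected components. The Euler genus is $\varepsilon(G)=2c(G)-|V(G)|+|E(G)|-|F(G)|$. For $A\subseteq E(G)$, the partial Petrial $G^{\times|A}$ is obtained by detaching one end of each edge-ribbon in $A$ from its incident vertex-disc, giving the edge a half-twist, and reattaching it. The partial Petrial polynomial is $^{\partial}\varepsilon_G^{\times}(z)=\sum_{A\subseteq E(G)}z^{\varepsilon(G^{\times|A})}$. A bouquet is a ribbon graph with exactly one vertex-disc. Two edges (loops) of a bouquet are interlaced if their half-edges alternate in the cyclic order of half-edges around the vertex-disc. The intersection graph $I(B)$ of a bouquet $B$ has the loops of $B$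 as vertices, two being adjacent if and only if the loops are interlaced. *)

theory Defs
  imports
    "HOL-Combinatorics.Orbits"
    "HOL-Computational_Algebra.Polynomial"
    "Graph_Theory.Kuratowski"
begin

text \<open>
  Ribbon graphs are presented combinatorially, up to homeomorphism, by the incidence data of
  vertex-discs, edge-ribbons and the line segments in which they meet (the half-edges).  Every
  vertex-disc carries a chosen orientation; \<open>rot\<close> sends a half-edge to the next one met when
  travelling along the boundary of its vertex-disc in that direction.  An edge-ribbon is
  \<open>twisted\<close> if it is glued in with a half-twist relative to the orientations
  of the vertex-discs at its two ends.
\<close>

record ('v, 'e, 'h) ribbon =
  vdiscs :: "'v set"
  eribbons :: "'e set"
  half_edges :: "'h set"
  vert_of :: "'h \<Rightarrow> 'v"
  edge_of :: "'h \<Rightarrow> 'e"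
  rot :: "'h \<Rightarrow> 'h"
  twisted :: "'e set"

definition half_edges_at :: "('v, 'e, 'h) ribbon \<Rightarrow> 'v \<Rightarrow> 'h set" where
  "half_edges_at G v = {h \<in> half_edges G. vert_of G h = v}"

locale ribbon_graph =
  fixes G :: "('v, 'e, 'h) ribbon"
  assumes finite_vdiscs: "finite (vdiscs G)"
    and finite_eribbons: "finite (eribbons G)"
    and vert_of_mem: "h \<in> half_edges G \<Longrightarrow> vert_of G h \<in> vdiscs G"
    and edge_of_mem: "h \<in> half_edges G \<Longrightarrow> edge_of G h \<in> eribbons G"
    and two_half_edges: "e \<in> eribbons G \<Longrightarrow> card {h \<in> half_edges G. edge_of G h = e} = 2"
    and rot_permutes: "rot G permutes half_edges G"
    and rot_cyclic: "v \<in> vdiscs G \<Longrightarrow> half_edges_at G v \<noteq> {} \<Longrightarrow>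
      cyclic_on (rot G) (half_edges_at G v)"
    and twisted_subset: "twisted G \<subseteq> eribbons G"

text \<open>
  Each half-edge \<open>h\<close> is a segment with two end points: \<open>(h, False)\<close> is met first and
  \<open>(h, True)\<close> last in the orientation of the vertex-disc.  The boundary of the surface consists
  of the arcs of the vertex-discs between consecutive segments, the two free sides of every
  edge-ribbon, and the whole boundary circles of the vertex-discs meeting no edge-ribbon.
  The free sides of an untwisted edge-ribbon join first end points to last ones (so that it
  preserves orientation), while those of a twisted one join first to first and last to last.
\<close>

definition corners :: "('v, 'e, 'h) ribbon \<Rightarrow> ('h \<times> bool) set" where
  "corners G = half_edges G \<times> UNIV"

definition vertex_arcs :: "('v, 'e, 'h) ribbon \<Rightarrow> ('h \<times> bool) rel" where
  "vertex_arcs G = {((h, True), (rot G h, False)) | h. h \<in> half_edges G}"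

definition ribbon_sides :: "('v, 'e, 'h) ribbon \<Rightarrow> ('h \<times> bool) rel" where
  "ribbon_sides G = {((h, b), (h', b')) | h b h' b'.
     h \<in> half_edges G \<and> h' \<in> half_edges G \<and> h \<noteq> h' \<and> edge_of G h = edge_of G h' \<and>
     (b = b' \<longleftrightarrow> edge_of G h \<in> twisted G)}"

definition equiv_closure :: "'a rel \<Rightarrow> 'a rel" where
  "equiv_closure R = (R \<union> R\<inverse>)\<^sup>*"

definition faces :: "('v, 'e, 'h) ribbon \<Rightarrow> (('h \<times> bool) set + 'v) set" where
  "faces G = (corners G // equiv_closure (vertex_arcs G \<union> ribbon_sides G))
     <+> {v \<in> vdiscs G. half_edges_at G v = {}}"

definition components :: "('v, 'e, 'h) ribbon \<Rightarrow> 'v set set" where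
  "components G = vdiscs G // equiv_closure {(vert_of G h, vert_of G h') | h h'.
     h \<in> half_edges G \<and> h' \<in> half_edges G \<and> edge_of G h = edge_of G h'}"

definition euler_genus :: "('v, 'e, 'h) ribbon \<Rightarrow> int" where
  "euler_genus G = 2 * int (card (components G)) - int (card (vdiscs G))
     + int (card (eribbons G)) - int (card (faces G))"

definition partial_petrial :: "('v, 'e, 'h) ribbon \<Rightarrow> 'e set \<Rightarrow> ('v, 'e, 'h) ribbon" where
  "partial_petrial G A = G\<lparr>twisted := (twisted G - A) \<union> (A - twisted G)\<rparr>"

text \<open>The Euler genus of a ribbon graph is never negative, so \<open>nat\<close> loses nothing here.\<close>

definition partial_petrial_polynomial :: "('v, 'e, 'h) ribbon \<Rightarrow> int poly" where
  "partial_petrial_polynomial G =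
     (\<Sum>A\<in>Pow (eribbons G). monom 1 (nat (euler_genus (partial_petrial G A))))"

locale bouquet = ribbon_graph +
  assumes one_vertex: "card (vdiscs G) = 1"

text \<open>
  In a bouquet \<open>rot\<close> is one cycle through all half-edges, so the four half-edges below are
  pairwise distinct and met in this cyclic order.
\<close>

definition interlaced :: "('v, 'e, 'h) ribbon \<Rightarrow> 'e \<Rightarrow> 'e \<Rightarrow> bool" where
  "interlaced B e f \<longleftrightarrow> e \<noteq> f \<and> (\<exists>h\<in>half_edges B. \<exists>a b c.
     0 < a \<and> a < b \<and> b < c \<and> c < card (half_edges B) \<and>
     edge_of B h = e \<and> edge_of B ((rot B ^^ a) h) = f \<and>
     edge_of B ((rot B ^^ b) h) = e \<and> edge_of B ((rot B ^^ c) h) = f)"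

text \<open>An undirected graph is a digraph with a symmetric arc relation, as in \<open>Graph_Theory\<close>.\<close>

definition intersection_graph :: "('v, 'e, 'h) ribbon \<Rightarrow> 'e pair_pre_digraph" where
  "intersection_graph B = \<lparr>pverts = eribbons B,
     parcs = {(e, f). e \<in> eribbons B \<and> f \<in> eribbons B \<and> interlaced B e f}\<rparr>"

end

theory Submission
  imports Defs
begin

text \<open>
  The Euler genus of a bouquet is the rank over the field with two elements of a symmetric matrix:
  the adjacency matrix of the intersection graph, with a diagonal entry \<open>1\<close> for every twisted
  loop.  Equivalently, the number of faces is one more than the nullity of this matrix.  The reason
  is a count of two-colourings of the corners (the end points of the half-edges) that are constant
  on every face.  There are \<open>2 ^ f\<close> of them when there are \<open>f\<close> faces (\<open>card_saturated_subsets\<close>).  On the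
  other hand, such a colouring is determined by the colour at one base corner and by the set \<open>X\<close> of
  loops across whose half-edges the colour changes.  A colouring built from \<open>X\<close> along the
  vertex-disc automatically agrees along the arcs of the disc, and it agrees along the free sides of
  a loop \<open>e\<close> iff the number of members of \<open>X\<close> interlaced with \<open>e\<close>, plus one if \<open>e\<close> is a twisted
  member of \<open>X\<close>, is even.  That is the equation of row \<open>e\<close> for the kernel of the matrix, so
  \<open>2 ^ f\<close> is twice the size of the kernel (\<open>two_power_card_faces\<close>).

  Taking partial Petrials alters only the set of twisted loops, and \<open>A \<mapsto> twisted B \<triangle> A\<close> is a
  bijection, so the polynomial is the sum of \<open>z\<close> to the rank over all possible diagonals.  When the
  intersection graph is complete bipartite with classes \<open>U\<close> and \<open>W\<close> of size \<open>i\<close>, let \<open>P \<subseteq> U\<close> and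
  \<open>Q \<subseteq> W\<close> be the twisted loops.  The rank is then \<open>card P + card Q + 2\<close> if both inclusions are
  proper.  If \<open>P = U\<close> and \<open>Q\<close> is proper, it is \<open>i + card Q + 1\<close> or \<open>i + card Q\<close> according as \<open>i\<close> is
  odd or even, and likewise with the classes exchanged.  If \<open>P = U\<close> and \<open>Q = W\<close>, it is \<open>2 * i - 1\<close>
  or \<open>2 * i\<close> (\<open>euler_genus_bipartite\<close>).  As the proper subsets of an \<open>i\<close>-element set contribute
  \<open>(1 + z) ^ i - z ^ i\<close> to a sum of \<open>z\<close> to the cardinality, these three kinds of diagonals yield the
  three summands of the formula.
\<close>

section \<open>Two-colourings that are constant on classes\<close>

text \<open>
  A set that does not separate related points is a union of classes of the generated equivalence
  relation, and the set of these classes can be chosen freely.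
\<close>

lemma card_saturated_subsets:
  assumes "finite C" and R: "R \<subseteq> C \<times> C"
  shows "card {S. S \<subseteq> C \<and> (\<forall>(x, y)\<in>R. x \<in> S \<longleftrightarrow> y \<in> S)} = 2 ^ card (C // equiv_closure R)"
proof -
  define E where "E = equiv_closure R"
  define Sat where "Sat = {S. S \<subseteq> C \<and> (\<forall>(x, y)\<in>R. x \<in> S \<longleftrightarrow> y \<in> S)}"
  have equiv: "equiv UNIV E"
    unfolding E_def equiv_closure_def
    by (intro equivI refl_rtrancl trans_rtrancl sym_rtrancl) (auto simp: sym_def)
  have sat: "x \<in> S \<longleftrightarrow> y \<in> S" if "(x, y) \<in> E" "S \<in> Sat" for x y S
    using that(1) unfolding E_def equiv_closure_def
    by (induction rule: rtrancl_induct) (use that(2) in \<open>auto simp: Sat_def\<close>)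
  have C: "C \<in> Sat" using R by (auto simp: Sat_def)
  have E_iff: "(x, y) \<in> E \<longleftrightarrow> E `` {x} = E `` {y}" for x y
    using eq_equiv_class_iff[OF equiv, of x y] by auto
  have self: "x \<in> E `` {x}" for x using equiv_class_self[OF equiv] by auto
  have R_E: "R \<subseteq> E" unfolding E_def equiv_closure_def by auto
  have un: "\<Union>(S // E) = S" if "S \<in> Sat" for S
    using that sat self by (fastforce simp: quotient_def)
  have quo: "\<Union>A // E = A" if A: "A \<subseteq> C // E" for A
  proof -
    have cls: "E `` {y} = c" if "c \<in> A" "y \<in> c" for c y
    proof -
      from that A obtain x where "c = E `` {x}" by (auto elim!: quotientE)
      with that show ?thesis using E_iff by auto
    qed
    moreover have "\<exists>y. y \<in> c" if "c \<in> A" for c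
      using that A self by (auto elim!: quotientE)
    ultimately show ?thesis unfolding quotient_def by fastforce
  qed
  have "bij_betw (\<lambda>S. S // E) Sat (Pow (C // E))"
  proof (rule bij_betw_byWitness[where f' = Union])
    show "(\<lambda>S. S // E) ` Sat \<subseteq> Pow (C // E)"
      by (auto simp: Sat_def quotient_def)
    show "Union ` Pow (C // E) \<subseteq> Sat"
    proof safe
      fix A assume A: "A \<subseteq> C // E"
      have "x \<in> C" if "x \<in> c" "c \<in> A" for x c
        using that A sat[OF _ C] by (auto elim!: quotientE)
      moreover have "x \<in> c \<longleftrightarrow> y \<in> c" if "(x, y) \<in> R" "c \<in> A" for x y c
      proof -
        from that A obtain u where "c = E `` {u}" by (auto elim!: quotientE)
        moreover have "(x, y) \<in> E" using that R_E by blast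
        ultimately show ?thesis using E_iff by auto
      qed
      ultimately show "\<Union>A \<in> Sat" unfolding Sat_def by blast
    qed
  qed (use un quo in auto)
  then have "card Sat = card (Pow (C // E))" by (rule bij_betw_same_card)
  moreover have "finite (C // E)" using assms(1) by (simp add: quotient_def)
  ultimately show ?thesis by (simp add: card_Pow Sat_def E_def)
qed

section \<open>Faces of a bouquet and the kernel of its interlacement matrix\<close>

text \<open>
  The kernel of the matrix described above, with vectors over the two-element field written as sets
  of loops: the condition for \<open>e\<close> says that row \<open>e\<close> is orthogonal to \<open>X\<close>.
\<close>

definition interlace_kernel :: "('v, 'e, 'h) ribbon \<Rightarrow> 'e set set" where
  "interlace_kernel B = {X. X \<subseteq> eribbons B \<and>
     (\<forall>e\<in>eribbons B. even (card {f \<in> X. interlaced B e f} + of_bool (e \<in> X \<and> e \<in> twisted B)))}"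

context bouquet
begin

lemma half_edges_at_eq: "v \<in> vdiscs G \<Longrightarrow> half_edges_at G v = half_edges G"
  using one_vertex vert_of_mem by (auto simp: half_edges_at_def card_1_singleton_iff)

lemma card_components: "card (components G) = 1"
  using one_vertex by (auto simp: components_def quotient_def card_1_singleton_iff)

end

text \<open>
  A base half-edge cuts the cyclic order around the disc open, so that half-edges become positions
  \<open>0, \<dots>, N - 1\<close> and interlacement becomes a statement about the order of natural numbers.
\<close>

locale based_bouquet = bouquet +
  fixes root
  assumes root_mem: "root \<in> half_edges G"
begin

definition N :: nat where "N = card (half_edges G)"

definition pos :: "nat \<Rightarrow> 'c" where "pos k = (rot G ^^ k) root"

definition edge_at :: "nat \<Rightarrow> 'b" where "edge_at k = edge_of G (pos k)"

lemma vdiscs_eq: "vdiscs G = {vert_of G root}"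
  using one_vertex vert_of_mem[OF root_mem] by (auto simp: card_1_singleton_iff)

lemma cyclic: "cyclic_on (rot G) (half_edges G)"
  using rot_cyclic[of "vert_of G root"] vdiscs_eq half_edges_at_eq[of "vert_of G root"] root_mem
  by auto

lemma finite_half_edges: "finite (half_edges G)"
  using cyclic by (rule finite_cyclic_on)

lemma bij_pos: "bij_betw pos {..<N} (half_edges G)"
  and pos_N: "pos N = root"
proof -
  let ?d = "funpow_dist1 (rot G) root root"
  have orb: "half_edges G = orbit (rot G) root"
    using cyclic root_mem by (auto simp: cyclic_on_alldef)
  then have root: "root \<in> orbit (rot G) root" using root_mem by simp
  have inj: "inj_on pos {..<?d}"
    using inj_on_funpow_dist1[OF root] by (simp add: pos_def[abs_def] atLeast0LessThan)
  have im: "pos ` {..<?d} = half_edges G"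
    using orbit_conv_funpow_dist1[OF root] orb by (simp add: pos_def[abs_def] atLeast0LessThan)
  have N: "N = ?d" using card_image[OF inj] im by (simp add: N_def)
  show "bij_betw pos {..<N} (half_edges G)" using inj im N by (auto simp: bij_betw_def)
  show "pos N = root" unfolding N pos_def by (rule funpow_dist1_prop[OF root])
qed

lemma pos_add_N: "pos (k + N) = pos k"
  using pos_N by (simp add: pos_def funpow_add)

lemma edge_at_add_N: "edge_at (k + N) = edge_at k"
  by (simp add: edge_at_def pos_add_N)

lemma pos_mem: "k < N \<Longrightarrow> pos k \<in> half_edges G"
  using bij_pos by (auto simp: bij_betw_def)

lemma pos_inj: "j < N \<Longrightarrow> k < N \<Longrightarrow> pos j = pos k \<longleftrightarrow> j = k"
  using bij_pos by (auto simp: bij_betw_def inj_on_def)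

lemma half_edge_posE:
  assumes "h \<in> half_edges G" obtains k where "k < N" "h = pos k"
  using assms bij_pos by (auto simp: bij_betw_def)

lemma rot_pos: "rot G (pos k) = pos (Suc k)"
  by (simp add: pos_def)

lemma N_pos: "0 < N"
  using root_mem finite_half_edges by (auto simp: N_def card_gt_0_iff)

lemma edge_at_mem: "k < N \<Longrightarrow> edge_at k \<in> eribbons G"
  by (simp add: edge_at_def edge_of_mem pos_mem)

lemma card_edge_positions:
  assumes "e \<in> eribbons G"
  shows "card {k. k < N \<and> edge_at k = e} = 2"
proof -
  have "bij_betw pos {k \<in> {..<N}. edge_at k = e} {h \<in> half_edges G. edge_of G h = e}"
    using bij_pos by (auto simp: bij_betw_def edge_at_def inj_on_def)
  then show ?thesis using two_half_edges[OF assms] bij_betw_same_card by fastforce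
qed

lemma edge_positionsE:
  assumes "e \<in> eribbons G"
  obtains j k where "j < k" "k < N" "\<And>l. l < N \<Longrightarrow> edge_at l = e \<longleftrightarrow> l = j \<or> l = k"
proof -
  obtain j k where jk: "{l. l < N \<and> edge_at l = e} = {j, k}" "j \<noteq> k"
    using card_edge_positions[OF assms] by (auto simp: card_2_iff)
  then have mem: "l < N \<and> edge_at l = e \<longleftrightarrow> l = j \<or> l = k" for l by blast
  show ?thesis
  proof (cases "j < k")
    case True
    then show ?thesis using mem that[of j k] by blast
  next
    case False
    then have "k < j" using jk(2) by simp
    then show ?thesis using mem that[of k j] by blast
  qed
qed

text \<open>
  Interlacement is defined by starting at an arbitrary half-edge and running once around the disc.
  The start may lie anywhere relative to the base, so positions beyond \<open>N\<close> have to be reduced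
  by \<open>N\<close>; which loop is met is unaffected.
\<close>

lemma interlaced_iff_positions:
  assumes jk: "j < k" "k < N" and e: "\<And>l. l < N \<Longrightarrow> edge_at l = e \<longleftrightarrow> l = j \<or> l = k"
    and ab: "a < b" "b < N" and f: "\<And>l. l < N \<Longrightarrow> edge_at l = f \<longleftrightarrow> l = a \<or> l = b"
    and "e \<noteq> f"
  shows "interlaced G e f \<longleftrightarrow> (j < a \<and> a < k) \<noteq> (j < b \<and> b < k)"
proof
  \<comment> \<open>With \<open>s\<close> the position of the start, the offsets in the definition lead to positions
    less than \<open>2 * N\<close>.\<close>
  have e': "l = j \<or> l = k \<or> l = j + N \<or> l = k + N" if "edge_at l = e" "l < 2 * N" for l
  proof (cases "l < N")
    case False
    then have "l - N < N" "edge_at (l - N) = e" using edge_at_add_N[of "l - N"] that by auto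
    then have "l - N = j \<or> l - N = k" using e by blast
    then show ?thesis using False by linarith
  qed (use that e in auto)
  have f': "l = a \<or> l = b \<or> l = a + N \<or> l = b + N" if "edge_at l = f" "l < 2 * N" for l
  proof (cases "l < N")
    case False
    then have "l - N < N" "edge_at (l - N) = f" using edge_at_add_N[of "l - N"] that by auto
    then have "l - N = a \<or> l - N = b" using f by blast
    then show ?thesis using False by linarith
  qed (use that f in auto)
  assume "interlaced G e f"
  then obtain h x y w where h: "h \<in> half_edges G" and o: "0 < x" "x < y" "y < w" "w < N"
    and eq: "edge_of G h = e" "edge_of G ((rot G ^^ x) h) = f"
      "edge_of G ((rot G ^^ y) h) = e" "edge_of G ((rot G ^^ w) h) = f"
    by (auto simp: interlaced_def N_def)
  obtain s where s: "s < N" "h = pos s" using h by (rule half_edge_posE)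
  have at: "edge_of G ((rot G ^^ m) h) = edge_at (s + m)" for m
    by (simp add: s edge_at_def pos_def funpow_add add.commute[of s])
  have at_s: "edge_at s = e" "edge_at (s + x) = f" "edge_at (s + y) = e" "edge_at (s + w) = f"
    using at[of 0] at eq by simp_all
  have "s = j \<or> s = k" using e[OF s(1)] at_s(1) by simp
  moreover have "s + y = j \<or> s + y = k \<or> s + y = j + N \<or> s + y = k + N"
    using e'[OF at_s(3)] s(1) o by simp
  moreover have "s + x = a \<or> s + x = b \<or> s + x = a + N \<or> s + x = b + N"
    using f'[OF at_s(2)] s(1) o by simp
  moreover have "s + w = a \<or> s + w = b \<or> s + w = a + N \<or> s + w = b + N"
    using f'[OF at_s(4)] s(1) o by simp
  ultimately show "(j < a \<and> a < k) \<noteq> (j < b \<and> b < k)"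
    using o jk ab s(1) by (elim disjE) linarith+
next
  have rot_j: "edge_of G ((rot G ^^ m) (pos j)) = edge_at (j + m)" for m
    by (simp add: edge_at_def pos_def funpow_add add.commute[of j])
  have intro: "interlaced G e f"
    if "0 < x" "x < y" "y < w" "w < N"
      "edge_at (j + x) = f" "edge_at (j + y) = e" "edge_at (j + w) = f" for x y w
    unfolding interlaced_def
    using that \<open>e \<noteq> f\<close> e[of j] jk pos_mem[of j] rot_j[of 0]
    by (intro conjI bexI[of _ "pos j"] exI[of _ x] exI[of _ y] exI[of _ w])
       (auto simp: rot_j N_def)
  have ne: "a \<noteq> j" "a \<noteq> k" "b \<noteq> j" "b \<noteq> k"
    using e f jk ab \<open>e \<noteq> f\<close> by (metis less_trans)+
  assume "(j < a \<and> a < k) \<noteq> (j < b \<and> b < k)"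
  then consider "j < a" "a < k" "k < b" | "a < j" "j < b" "b < k"
    using ne ab by linarith
  then show "interlaced G e f"
  proof cases
    case 1
    show ?thesis
      by (rule intro[of "a - j" "k - j" "b - j"]) (use 1 jk ab e f in auto)
  next
    case 2
    show ?thesis
      by (rule intro[of "b - j" "k - j" "a + N - j"]) (use 2 jk ab e f edge_at_add_N[of a] in auto)
  qed
qed

text \<open>
  Running around the disc from the base, the colour has to change at every half-edge of a loop in
  \<open>X\<close>; this is the parity of the number of changes made before reaching position \<open>k\<close>.
\<close>

definition parity_before :: "'b set \<Rightarrow> nat \<Rightarrow> bool" where
  "parity_before X k \<longleftrightarrow> odd (card {l. l < k \<and> edge_at l \<in> X})"

lemma parity_before_0: "\<not> parity_before X 0"
  by (simp add: parity_before_def)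

lemma parity_before_Suc: "parity_before X (Suc k) \<longleftrightarrow> parity_before X k \<noteq> (edge_at k \<in> X)"
proof -
  have "{l. l < Suc k \<and> edge_at l \<in> X} =
      (if edge_at k \<in> X then insert k {l. l < k \<and> edge_at l \<in> X} else {l. l < k \<and> edge_at l \<in> X})"
    by (auto simp: less_Suc_eq)
  then show ?thesis by (auto simp: parity_before_def)
qed

lemma card_positions_in:
  assumes "X \<subseteq> eribbons G"
  shows "card {l. m \<le> l \<and> l < n \<and> edge_at l \<in> X} = (\<Sum>f\<in>X. card {l. m \<le> l \<and> l < n \<and> edge_at l = f})"
proof -
  have "{l. m \<le> l \<and> l < n \<and> edge_at l \<in> X} = (\<Union>f\<in>X. {l. m \<le> l \<and> l < n \<and> edge_at l = f})" by auto
  also have "card \<dots> = (\<Sum>f\<in>X. card {l. m \<le> l \<and> l < n \<and> edge_at l = f})"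
    using finite_subset[OF assms finite_eribbons] by (intro card_UN_disjoint) auto
  finally show ?thesis .
qed

text \<open>
  Every loop has two half-edges, so the colour after a full turn is the initial one.
\<close>

lemma parity_before_N: "X \<subseteq> eribbons G \<Longrightarrow> \<not> parity_before X N"
  using card_positions_in[of X 0 N] card_edge_positions
  by (simp add: parity_before_def subset_iff)

text \<open>
  Strictly between the two ends of \<open>e\<close>, a loop interlaced with \<open>e\<close> has one half-edge and any other
  loop has none or two, so modulo two the changes of colour count the interlaced members of \<open>X\<close>.
\<close>

lemma parity_between_ends:
  assumes X: "X \<subseteq> eribbons G" and "e \<in> eribbons G"
    and jk: "j < k" "k < N" and e: "\<And>l. l < N \<Longrightarrow> edge_at l = e \<longleftrightarrow> l = j \<or> l = k"
  shows "parity_before X (Suc j) \<noteq> parity_before X k \<longleftrightarrow> odd (card {f \<in> X. interlaced G e f})"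
proof -
  have "{l. l < k \<and> edge_at l \<in> X} =
      {l. l < Suc j \<and> edge_at l \<in> X} \<union> {l. Suc j \<le> l \<and> l < k \<and> edge_at l \<in> X}"
    using jk by auto
  moreover have "card ({l. l < Suc j \<and> edge_at l \<in> X} \<union> {l. Suc j \<le> l \<and> l < k \<and> edge_at l \<in> X}) =
      card {l. l < Suc j \<and> edge_at l \<in> X} + card {l. Suc j \<le> l \<and> l < k \<and> edge_at l \<in> X}"
    by (rule card_Un_disjoint) auto
  ultimately have "card {l. l < k \<and> edge_at l \<in> X} =
      card {l. l < Suc j \<and> edge_at l \<in> X} + card {l. Suc j \<le> l \<and> l < k \<and> edge_at l \<in> X}"
    by (rule trans[OF arg_cong[of _ _ card]])
  then have "parity_before X (Suc j) \<noteq> parity_before X k \<longleftrightarrow>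
      odd (card {l. Suc j \<le> l \<and> l < k \<and> edge_at l \<in> X})"
    by (auto simp: parity_before_def)
  also have "\<dots> \<longleftrightarrow> odd (card {f \<in> X. odd (card {l. Suc j \<le> l \<and> l < k \<and> edge_at l = f})})"
    using finite_subset[OF X finite_eribbons] by (simp add: card_positions_in[OF X] even_sum_iff)
  also have "{f \<in> X. odd (card {l. Suc j \<le> l \<and> l < k \<and> edge_at l = f})} = {f \<in> X. interlaced G e f}"
  proof (rule Collect_cong, rule conj_cong[OF refl])
    fix f assume "f \<in> X"
    then have "f \<in> eribbons G" using X by auto
    then obtain a b where ab: "a < b" "b < N" and f: "\<And>l. l < N \<Longrightarrow> edge_at l = f \<longleftrightarrow> l = a \<or> l = b"
      by (rule edge_positionsE) blast
    show "odd (card {l. Suc j \<le> l \<and> l < k \<and> edge_at l = f}) \<longleftrightarrow> interlaced G e f"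
    proof (cases "e = f")
      case True
      then have none: "{l. Suc j \<le> l \<and> l < k \<and> edge_at l = f} = {}" using e jk by auto
      show ?thesis unfolding none using True by (simp add: interlaced_def)
    next
      case False
      have "Suc j \<le> l \<and> l < k \<and> edge_at l = f \<longleftrightarrow> Suc j \<le> l \<and> l < k \<and> (l = a \<or> l = b)" for l
        using f[of l] jk by auto
      then have "{l. Suc j \<le> l \<and> l < k \<and> edge_at l = f} = {l. Suc j \<le> l \<and> l < k \<and> (l = a \<or> l = b)}"
        by (rule Collect_cong)
      also have "\<dots> = (if j < a \<and> a < k then {a} else {}) \<union> (if j < b \<and> b < k then {b} else {})"
        by auto
      finally have "{l. Suc j \<le> l \<and> l < k \<and> edge_at l = f} =
          (if j < a \<and> a < k then {a} else {}) \<union> (if j < b \<and> b < k then {b} else {})" .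
      then show ?thesis
        using interlaced_iff_positions[OF jk e ab f False] ab by auto
    qed
  qed
  finally show ?thesis .
qed

text \<open>
  The first corner of the half-edge at position \<open>k\<close> precedes the possible change of colour there and
  the last corner follows it, whence \<open>k + of_bool t\<close>.
\<close>

definition colouring :: "bool \<Rightarrow> 'b set \<Rightarrow> ('c \<times> bool) set" where
  "colouring b X = {(pos k, t) | k t. k < N \<and> (b \<noteq> parity_before X (k + of_bool t))}"

lemma colouring_iff:
  "k < N \<Longrightarrow> (pos k, t) \<in> colouring b X \<longleftrightarrow> (b \<noteq> parity_before X (k + of_bool t))"
  by (auto simp: colouring_def pos_inj)

definition saturated_under :: "('c \<times> bool) set \<Rightarrow> ('c \<times> bool) rel \<Rightarrow> bool" where
  "saturated_under S R \<longleftrightarrow> (\<forall>(x, y)\<in>R. x \<in> S \<longleftrightarrow> y \<in> S)"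

lemma colouring_respects_vertex_arcs:
  assumes "X \<subseteq> eribbons G"
  shows "saturated_under (colouring b X) (vertex_arcs G)"
proof -
  have "(pos k, True) \<in> colouring b X \<longleftrightarrow> (pos (Suc k), False) \<in> colouring b X" if "k < N" for k
  proof (cases "Suc k < N")
    case True
    then show ?thesis by (simp add: colouring_iff)
  next
    case False
    then have "Suc k = N" using that by simp
    moreover have "pos N = pos 0" using pos_add_N[of 0] by simp
    ultimately show ?thesis
      using that N_pos parity_before_N[OF assms] by (simp add: colouring_iff parity_before_0)
  qed
  then show ?thesis
    by (auto simp: saturated_under_def vertex_arcs_def rot_pos elim!: half_edge_posE)
qed

text \<open>
  Let \<open>j < k\<close> be the positions of the ends of \<open>e\<close>.  Each side of \<open>e\<close> joins two corners and asks
  for an even number of changes of colour on the stretch between them.  If \<open>e\<close> is untwisted, the two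
  stretches contain neither or both of the half-edges of \<open>e\<close>, so that \<open>e\<close> itself contributes an even
  number.  If \<open>e\<close> is twisted, each stretch contains one of them, which adds one change precisely when
  \<open>e \<in> X\<close>.
\<close>

lemma colouring_respects_ribbon_sides_iff:
  assumes X: "X \<subseteq> eribbons G"
  shows "saturated_under (colouring b X) (ribbon_sides G) \<longleftrightarrow> X \<in> interlace_kernel G"
proof -
  let ?C = "colouring b X"
  define side_ok where "side_ok e \<longleftrightarrow> (\<forall>h t h' t'.
    ((h, t), (h', t')) \<in> ribbon_sides G \<and> edge_of G h = e \<longrightarrow> ((h, t) \<in> ?C \<longleftrightarrow> (h', t') \<in> ?C))" for e
  have "edge_of G h \<in> eribbons G" if "((h, t), y) \<in> ribbon_sides G" for h t y
    using that edge_of_mem by (auto simp: ribbon_sides_def)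
  then have "saturated_under ?C (ribbon_sides G) \<longleftrightarrow> (\<forall>e\<in>eribbons G. side_ok e)"
    unfolding saturated_under_def side_ok_def by (auto; blast)
  also have "\<dots> \<longleftrightarrow> (\<forall>e\<in>eribbons G.
      even (card {f \<in> X. interlaced G e f} + of_bool (e \<in> X \<and> e \<in> twisted G)))"
  proof (rule ball_cong[OF refl])
    fix e assume e_mem: "e \<in> eribbons G"
    then obtain j k where jk: "j < k" "k < N" and e: "\<And>l. l < N \<Longrightarrow> edge_at l = e \<longleftrightarrow> l = j \<or> l = k"
      by (rule edge_positionsE) blast
    have e_ends: "h \<in> half_edges G \<and> edge_of G h = e \<longleftrightarrow> h = pos j \<or> h = pos k" for h
    proof
      assume "h \<in> half_edges G \<and> edge_of G h = e"
      then show "h = pos j \<or> h = pos k" using e by (auto simp: edge_at_def elim!: half_edge_posE)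
    next
      assume "h = pos j \<or> h = pos k"
      then show "h \<in> half_edges G \<and> edge_of G h = e"
        using e[of j] e[of k] jk pos_mem[of j] pos_mem[of k] by (auto simp: edge_at_def)
    qed
    have ne: "pos j \<noteq> pos k" using jk pos_inj by auto
    have sides: "((h, t), (h', t')) \<in> ribbon_sides G \<and> edge_of G h = e \<longleftrightarrow>
        (h = pos j \<and> h' = pos k \<or> h = pos k \<and> h' = pos j) \<and> (t = t' \<longleftrightarrow> e \<in> twisted G)"
      (is "?side \<longleftrightarrow> _") for h t h' t'
    proof -
      have "?side \<longleftrightarrow> ((h \<in> half_edges G \<and> edge_of G h = e) \<and> (h' \<in> half_edges G \<and> edge_of G h' = e) \<and>
          h \<noteq> h') \<and> (t = t' \<longleftrightarrow> e \<in> twisted G)"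
        by (auto simp: ribbon_sides_def)
      moreover have "(h = pos j \<or> h = pos k) \<and> (h' = pos j \<or> h' = pos k) \<and> h \<noteq> h' \<longleftrightarrow>
          h = pos j \<and> h' = pos k \<or> h = pos k \<and> h' = pos j"
        using ne by metis
      ultimately show ?thesis by (simp only: e_ends)
    qed
    have "side_ok e \<longleftrightarrow> (\<forall>t t'. (t = t' \<longleftrightarrow> e \<in> twisted G) \<longrightarrow>
        ((pos j, t) \<in> ?C \<longleftrightarrow> (pos k, t') \<in> ?C))" (is "_ \<longleftrightarrow> ?ends_ok")
    proof
      assume "side_ok e"
      then show ?ends_ok unfolding side_ok_def sides by simp
    next
      assume ok: ?ends_ok
      show "side_ok e" unfolding side_ok_def sides
      proof (intro allI impI)
        fix h h' and t t' :: bool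
        assume "(h = pos j \<and> h' = pos k \<or> h = pos k \<and> h' = pos j) \<and> (t = t' \<longleftrightarrow> e \<in> twisted G)"
        then show "(h, t) \<in> ?C \<longleftrightarrow> (h', t') \<in> ?C"
          using ok[rule_format, of t t'] ok[rule_format, of t' t] by (cases t; cases t') auto
      qed
    qed
    also have "\<dots> \<longleftrightarrow> (\<forall>t t'. (t = t' \<longleftrightarrow> e \<in> twisted G) \<longrightarrow>
        (parity_before X (j + of_bool t) \<longleftrightarrow> parity_before X (k + of_bool t')))"
      using jk by (cases b) (simp_all add: colouring_iff all_bool_eq)
    also have "\<dots> \<longleftrightarrow> ((parity_before X (Suc j) \<noteq> parity_before X k) \<longleftrightarrow> e \<in> X \<and> e \<in> twisted G)"
      using e[of j] e[of k] jk parity_before_Suc[of X j] parity_before_Suc[of X k]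
      by (cases "e \<in> twisted G") (auto simp: all_bool_eq)
    also have "\<dots> \<longleftrightarrow> even (card {f \<in> X. interlaced G e f} + of_bool (e \<in> X \<and> e \<in> twisted G))"
      using parity_between_ends[OF X e_mem jk e] by auto
    finally show "side_ok e \<longleftrightarrow>
      even (card {f \<in> X. interlaced G e f} + of_bool (e \<in> X \<and> e \<in> twisted G))" .
  qed
  finally show ?thesis using X by (simp add: interlace_kernel_def)
qed

text \<open>
  The sides of a ribbon transport a change of colour from one of its ends to the other, in the
  untwisted and in the twisted case alike.  Hence the half-edges where the colour changes are those
  of a set of loops, and the colours can be recovered by running around the disc.
\<close>

lemma respecting_set_is_colouring:
  assumes S: "S \<subseteq> corners G" and arcs: "saturated_under S (vertex_arcs G)"
    and sides: "saturated_under S (ribbon_sides G)"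
  obtains b X where "X \<subseteq> eribbons G" "S = colouring b X"
proof -
  define changes where "changes h \<longleftrightarrow> ((h, False) \<in> S) \<noteq> ((h, True) \<in> S)" for h
  define X where "X = edge_of G ` {h \<in> half_edges G. changes h}"
  define b where "b \<longleftrightarrow> (root, False) \<in> S"
  have changes_cong: "changes h \<longleftrightarrow> changes h'"
    if "h \<in> half_edges G" "h' \<in> half_edges G" "edge_of G h = edge_of G h'" for h h'
  proof (cases "h = h'")
    case False
    \<comment> \<open>A twist exchanges the two corners at one end, which leaves their being coloured
      differently unaffected.\<close>
    have "(h, t) \<in> S \<longleftrightarrow> (h', t') \<in> S" if "t = t' \<longleftrightarrow> edge_of G h \<in> twisted G" for t t'
      using sides False \<open>h \<in> _\<close> \<open>h' \<in> _\<close> \<open>edge_of G h = _\<close> that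
      unfolding saturated_under_def ribbon_sides_def by blast
    then show ?thesis unfolding changes_def by (cases "edge_of G h \<in> twisted G") blast+
  qed simp
  have X_iff: "edge_of G h \<in> X \<longleftrightarrow> changes h" if "h \<in> half_edges G" for h
    using that changes_cong unfolding X_def by blast
  have arc: "(pos k, True) \<in> S \<longleftrightarrow> (pos (Suc k), False) \<in> S" if "k < N" for k
    using arcs pos_mem[OF that] by (auto simp: saturated_under_def vertex_arcs_def rot_pos)
  have step: "((pos k, True) \<in> S) \<noteq> ((pos k, False) \<in> S) \<longleftrightarrow> edge_at k \<in> X" if "k < N" for k
    using X_iff[OF pos_mem[OF that]] by (auto simp: edge_at_def changes_def)
  have first: "(pos k, False) \<in> S \<longleftrightarrow> (b \<noteq> parity_before X k)" if "k < N" for k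
    using that
  proof (induction k)
    case 0
    then show ?case by (simp add: b_def pos_def parity_before_0)
  next
    case (Suc k)
    then show ?case using arc[of k] step[of k] by (auto simp: parity_before_Suc)
  qed
  have all: "(pos k, t) \<in> S \<longleftrightarrow> (b \<noteq> parity_before X (k + of_bool t))" if "k < N" for k t
    using first[OF that] step[OF that] by (cases t) (auto simp: parity_before_Suc)
  have "x \<in> S \<longleftrightarrow> x \<in> colouring b X" for x
  proof (cases "fst x \<in> half_edges G")
    case True
    then obtain k where "k < N" "fst x = pos k" by (rule half_edge_posE)
    then show ?thesis using all[of k "snd x"] colouring_iff[of k "snd x" b X]
      by (metis prod.collapse)
  next
    case False
    then show ?thesis using S pos_mem by (auto simp: corners_def colouring_def)
  qed
  moreover have "X \<subseteq> eribbons G" by (auto simp: X_def edge_of_mem)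
  ultimately show ?thesis using that[of X b] by blast
qed

lemma inj_on_colouring: "inj_on (\<lambda>(b, X). colouring b X) (UNIV \<times> Pow (eribbons G))"
proof (rule inj_onI, clarify)
  fix b X b' X'
  assume X: "X \<subseteq> eribbons G" "X' \<subseteq> eribbons G" and eq: "colouring b X = colouring b' X'"
  have iff: "(b \<noteq> parity_before X (k + of_bool t)) \<longleftrightarrow> (b' \<noteq> parity_before X' (k + of_bool t))"
    if "k < N" for k t
    using colouring_iff[OF that, of t b X] colouring_iff[OF that, of t b' X'] eq by simp
  have b: "b = b'" using iff[OF N_pos, of False] by (auto simp: parity_before_0)
  have mem: "edge_at k \<in> X \<longleftrightarrow> edge_at k \<in> X'" if "k < N" for k
    using iff[OF that, of False] iff[OF that, of True] b by (auto simp: parity_before_Suc)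
  have "e \<in> X \<longleftrightarrow> e \<in> X'" if "e \<in> eribbons G" for e
    using edge_positionsE[OF that] mem by metis
  with X b show "b = b' \<and> X = X'" by blast
qed

lemma two_power_card_faces: "2 ^ card (faces G) = 2 * card (interlace_kernel G)"
proof -
  let ?R = "vertex_arcs G \<union> ribbon_sides G"
  let ?Sat = "{S. S \<subseteq> corners G \<and> (\<forall>(x, y)\<in>?R. x \<in> S \<longleftrightarrow> y \<in> S)}"
  have R: "?R \<subseteq> corners G \<times> corners G"
    using permutes_in_image[OF rot_permutes]
    by (auto simp: corners_def vertex_arcs_def ribbon_sides_def)
  have fin: "finite (corners G)" by (simp add: corners_def finite_half_edges)
  have no_bare_disc: "{v \<in> vdiscs G. half_edges_at G v = {}} = {}"
    using half_edges_at_eq root_mem by auto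
  have "card (faces G) = card (corners G // equiv_closure ?R)"
    unfolding faces_def no_bare_disc using fin
    by (subst card_Plus) (auto simp: quotient_def)
  then have "2 ^ card (faces G) = card ?Sat"
    using card_saturated_subsets[OF fin R] by simp
  also have Sat: "?Sat = {S. S \<subseteq> corners G \<and> saturated_under S (vertex_arcs G) \<and> saturated_under S (ribbon_sides G)}"
    by (auto simp: saturated_under_def)
  also have "\<dots> = (\<lambda>(b, X). colouring b X) ` (UNIV \<times> interlace_kernel G)" (is "?L = ?I")
  proof
    show "?L \<subseteq> ?I"
    proof safe
      fix S assume S: "S \<subseteq> corners G" "saturated_under S (vertex_arcs G)" "saturated_under S (ribbon_sides G)"
      then obtain b X where X: "X \<subseteq> eribbons G" "S = colouring b X"
        by (rule respecting_set_is_colouring)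
      with S have "X \<in> interlace_kernel G" using colouring_respects_ribbon_sides_iff by blast
      with X show "S \<in> ?I" by auto
    qed
    have "X \<subseteq> eribbons G" if "X \<in> interlace_kernel G" for X
      using that by (simp add: interlace_kernel_def)
    moreover have "colouring b X \<subseteq> corners G" for b X
      using pos_mem by (auto simp: colouring_def corners_def)
    ultimately show "?I \<subseteq> ?L"
      using colouring_respects_vertex_arcs colouring_respects_ribbon_sides_iff
      by (simp add: image_subset_iff)
  qed
  also have "card \<dots> = card ((UNIV :: bool set) \<times> interlace_kernel G)"
    by (intro card_image inj_on_subset[OF inj_on_colouring]) (auto simp: interlace_kernel_def)
  also have "\<dots> = 2 * card (interlace_kernel G)"
    by (simp add: card_cartesian_product)
  finally show ?thesis .
qed

end

text \<open>
  With one vertex and one component the Euler genus is \<open>1 + card (eribbons G) - card (faces G)\<close>, and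
  the colour of the base corner accounts for one face beyond the nullity \<open>d\<close>.
\<close>

lemma (in bouquet) euler_genus_eq_corank:
  assumes "eribbons G \<noteq> {}" and ker: "card (interlace_kernel G) = 2 ^ d"
  shows "euler_genus G = int (card (eribbons G)) - int d"
proof -
  obtain e where "e \<in> eribbons G" using assms by blast
  then have "card {h \<in> half_edges G. edge_of G h = e} \<noteq> 0" by (simp add: two_half_edges)
  then have "{h \<in> half_edges G. edge_of G h = e} \<noteq> {}" by (metis card.empty)
  then obtain root where "root \<in> half_edges G" by blast
  then interpret based_bouquet G root by unfold_locales
  have "(2::nat) ^ card (faces G) = 2 ^ Suc d" using two_power_card_faces ker by simp
  then have "card (faces G) = Suc d" by (subst (asm) power_inject_exp) auto
  then show ?thesis by (simp add: euler_genus_def card_components one_vertex)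
qed

section \<open>The kernel for a complete bipartite intersection graph\<close>

definition even_subsets :: "'a set \<Rightarrow> 'a set set" where
  "even_subsets S = {P. P \<subseteq> S \<and> even (card P)}"

text \<open>
  Fix \<open>x \<in> S\<close>: a subset of \<open>S - {x}\<close> extends to exactly one even subset of \<open>S\<close>, as the parity
  decides whether \<open>x\<close> must be added.
\<close>

lemma card_even_subsets:
  assumes "finite S" "S \<noteq> {}"
  shows "card (even_subsets S) = 2 ^ (card S - 1)"
proof -
  obtain x where x: "x \<in> S" using assms by blast
  let ?S' = "S - {x}"
  have fin: "finite P" if "P \<subseteq> S" for P using that assms(1) finite_subset by blast
  have "bij_betw (\<lambda>P. P - {x}) (even_subsets S) (Pow ?S')"
  proof (rule bij_betw_byWitness[where f' = "\<lambda>Q. if even (card Q) then Q else insert x Q"])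
    show "\<forall>P\<in>even_subsets S. (if even (card (P - {x})) then P - {x} else insert x (P - {x})) = P"
    proof
      fix P assume P: "P \<in> even_subsets S"
      then have "finite P" using fin by (simp add: even_subsets_def)
      then show "(if even (card (P - {x})) then P - {x} else insert x (P - {x})) = P"
        using P card_Suc_Diff1[of P x] by (cases "x \<in> P") (auto simp: even_subsets_def)
    qed
    show "(\<lambda>Q. if even (card Q) then Q else insert x Q) ` Pow ?S' \<subseteq> even_subsets S"
    proof
      fix R assume "R \<in> (\<lambda>Q. if even (card Q) then Q else insert x Q) ` Pow ?S'"
      then obtain Q where Q: "Q \<subseteq> ?S'" "R = (if even (card Q) then Q else insert x Q)" by blast
      then have "finite Q" "x \<notin> Q" using fin by auto
      with Q x show "R \<in> even_subsets S" by (auto simp: even_subsets_def)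
    qed
  qed (auto simp: even_subsets_def)
  then have "card (even_subsets S) = card (Pow ?S')" by (rule bij_betw_same_card)
  also have "\<dots> = 2 ^ (card S - 1)" using assms(1) x by (simp add: card_Pow)
  finally show ?thesis .
qed

text \<open>
  The equations of \<open>interlace_kernel\<close> for a complete bipartite graph with classes \<open>U\<close> and \<open>W\<close> and
  twisted set \<open>T\<close>: a solution is split into its parts \<open>P\<close> and \<open>Q\<close> in the two classes, and the
  neighbours of a vertex are the whole opposite class.
\<close>

definition bipartite_kernel :: "'a set \<Rightarrow> 'a set \<Rightarrow> 'a set \<Rightarrow> ('a set \<times> 'a set) set" where
  "bipartite_kernel U W T = {(P, Q). P \<subseteq> U \<and> Q \<subseteq> W \<and>
     (\<forall>e\<in>U. even (card Q + of_bool (e \<in> P \<and> e \<in> T))) \<and>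
     (\<forall>e\<in>W. even (card P + of_bool (e \<in> Q \<and> e \<in> T)))}"

lemma card_bipartite_kernel_swap: "card (bipartite_kernel W U T) = card (bipartite_kernel U W T)"
proof -
  have "bipartite_kernel W U T = prod.swap ` bipartite_kernel U W T"
    by (force simp: bipartite_kernel_def)
  then show ?thesis by (simp add: card_image)
qed

text \<open>
  All rows of one class share the parity of \<open>card Q\<close>.  If it is even, no twisted loop of \<open>U\<close> may
  occur in \<open>P\<close>; if it is odd, every loop of \<open>U\<close> has to be twisted and to occur in \<open>P\<close>.
\<close>

lemma even_rows_iff:
  assumes "P \<subseteq> U"
  shows "(\<forall>e\<in>U. even (card Q + of_bool (e \<in> P \<and> e \<in> T))) \<longleftrightarrow>
    (if even (card Q) then P \<inter> T = {} else U \<subseteq> T \<and> P = U)"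
  using assms by (auto split: if_splits)

lemma bipartite_kernel_eq:
  "bipartite_kernel U W T = {(P, Q). P \<subseteq> U \<and> Q \<subseteq> W \<and>
     (if even (card Q) then P \<inter> T = {} else U \<subseteq> T \<and> P = U) \<and>
     (if even (card P) then Q \<inter> T = {} else W \<subseteq> T \<and> Q = W)}"
  by (auto simp: bipartite_kernel_def even_rows_iff simp del: even_add)

text \<open>
  An untwisted loop in \<open>U\<close> forces \<open>card Q\<close> to be even, and one in \<open>W\<close> forces \<open>card P\<close> to be even;
  then \<open>P\<close> and \<open>Q\<close> are arbitrary even sets of untwisted loops.
\<close>

lemma card_bipartite_kernel_neither_full:
  assumes "finite U" "finite W" "\<not> U \<subseteq> T" "\<not> W \<subseteq> T"
  shows "card (bipartite_kernel U W T) = 2 ^ (card (U - T) - 1 + (card (W - T) - 1))"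
proof -
  have "bipartite_kernel U W T = even_subsets (U - T) \<times> even_subsets (W - T)"
    using assms(3,4) by (auto simp: bipartite_kernel_eq even_subsets_def split: if_splits)
  moreover have "U - T \<noteq> {}" "W - T \<noteq> {}" using assms by auto
  ultimately show ?thesis
    using assms(1,2) by (simp add: card_cartesian_product card_even_subsets power_add)
qed

text \<open>
  An untwisted loop in \<open>W\<close> forces \<open>card P\<close> to be even, so that \<open>Q\<close> consists of untwisted loops, while
  \<open>P\<close> is empty or all of \<open>U\<close> according to the parity of \<open>card Q\<close>.  If \<open>card U\<close> is odd, the latter
  possibility is excluded and \<open>Q\<close> is even; otherwise \<open>Q\<close> is arbitrary.
\<close>

lemma card_bipartite_kernel_one_full:
  assumes "finite W" "U \<subseteq> T" "\<not> W \<subseteq> T"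
  shows "card (bipartite_kernel U W T) =
    2 ^ (if odd (card U) then card (W - T) - 1 else card (W - T))"
proof (cases "odd (card U)")
  case True
  then have "bipartite_kernel U W T = {{}} \<times> even_subsets (W - T)"
    using assms(2,3) by (auto simp: bipartite_kernel_eq even_subsets_def split: if_splits)
  moreover have "W - T \<noteq> {}" using assms by auto
  ultimately show ?thesis
    using assms(1) True by (simp add: card_cartesian_product card_even_subsets)
next
  case False
  have empty_iff: "P \<subseteq> U \<and> P \<inter> T = {} \<longleftrightarrow> P = {}" for P
    using assms(2) by blast
  define f where "f Q = (if even (card Q) then {} else U)" for Q :: "'a set"
  have mem: "(P, Q) \<in> bipartite_kernel U W T \<longleftrightarrow> Q \<in> Pow (W - T) \<and> P = f Q" for P Q
  proof (cases "even (card Q)")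
    case True
    then have "(P, Q) \<in> bipartite_kernel U W T \<longleftrightarrow> P = {} \<and> Q \<subseteq> W \<and> Q \<inter> T = {}"
      using empty_iff[of P] assms(3) by (auto simp: bipartite_kernel_eq)
    with True show ?thesis by (auto simp: f_def)
  next
    assume "odd (card Q)"
    then show ?thesis using False assms(2,3) by (auto simp: bipartite_kernel_eq f_def)
  qed
  have "bipartite_kernel U W T = {(P, Q). Q \<in> Pow (W - T) \<and> P = f Q}"
    by (intro set_eqI) (simp only: split_paired_all mem mem_Collect_eq prod.case)
  also have "\<dots> = (\<lambda>Q. (f Q, Q)) ` Pow (W - T)" by blast
  finally have "card (bipartite_kernel U W T) = card ((\<lambda>Q. (f Q, Q)) ` Pow (W - T))" by simp
  also have "\<dots> = card (Pow (W - T))" by (intro card_image inj_onI) simp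
  finally show ?thesis using assms(1) False by (simp add: card_Pow)
qed

text \<open>
  If all loops are twisted, \<open>P\<close> is empty or \<open>U\<close> according to the parity of \<open>card Q\<close>, and \<open>Q\<close> is empty
  or \<open>W\<close> according to the parity of \<open>card P\<close>.  Besides the trivial solution this leaves \<open>(U, W)\<close>, a
  solution exactly for odd classes.
\<close>

lemma card_bipartite_kernel_both_full:
  assumes "U \<subseteq> T" "W \<subseteq> T" and "even (card U) \<longleftrightarrow> even (card W)"
  shows "card (bipartite_kernel U W T) = 2 ^ of_bool (odd (card U))"
proof (cases "odd (card U)")
  case True
  then have "U \<noteq> {}" by auto
  moreover have "bipartite_kernel U W T = {({}, {}), (U, W)}"
    using assms True by (auto simp: bipartite_kernel_eq split: if_splits)
  ultimately show ?thesis using True by simp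
next
  case False
  have "P = {} \<and> Q = {}" if "(P, Q) \<in> bipartite_kernel U W T" for P Q
  proof -
    have Q: "P = U" if "odd (card Q)"
      using that \<open>(P, Q) \<in> _\<close> by (simp add: bipartite_kernel_eq)
    have P: "Q = {}" if "even (card P)"
      using that \<open>(P, Q) \<in> _\<close> assms(2) by (simp add: bipartite_kernel_eq) blast
    have "even (card Q)"
      using Q P False by (metis card.empty even_zero)
    then have "P = {}"
      using \<open>(P, Q) \<in> _\<close> assms(1) by (simp add: bipartite_kernel_eq) blast
    with P show ?thesis by simp
  qed
  moreover have "({}, {}) \<in> bipartite_kernel U W T" by (simp add: bipartite_kernel_eq)
  ultimately have "bipartite_kernel U W T = {({}, {})}" by auto
  then show ?thesis using False by simp
qed

lemma card_interlace_kernel_bipartite: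
  assumes E: "eribbons B = U \<union> W" and disj: "U \<inter> W = {}" and "finite U" "finite W"
    and adj: "\<And>e f. e \<in> U \<union> W \<Longrightarrow> f \<in> U \<union> W \<Longrightarrow>
      interlaced B e f \<longleftrightarrow> (e, f) \<in> U \<times> W \<union> W \<times> U"
  shows "card (interlace_kernel B) = card (bipartite_kernel U W (twisted B))"
proof -
  have "bij_betw (\<lambda>X. (X \<inter> U, X \<inter> W)) (interlace_kernel B) (bipartite_kernel U W (twisted B))"
  proof (rule bij_betw_byWitness[where f' = "\<lambda>(P, Q). P \<union> Q"])
    have not_U: "e \<notin> U" if "e \<in> W" for e using that disj by auto
    have nbr: "{f \<in> X. interlaced B e f} = (if e \<in> U then X \<inter> W else X \<inter> U)"
      if "X \<subseteq> U \<union> W" "e \<in> U \<union> W" for X e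
      using that disj adj[of e] by auto
    have ker: "X \<in> interlace_kernel B \<longleftrightarrow> (X \<inter> U, X \<inter> W) \<in> bipartite_kernel U W (twisted B)"
      if X: "X \<subseteq> U \<union> W" for X
    proof -
      have "X \<in> interlace_kernel B \<longleftrightarrow> (\<forall>e\<in>U \<union> W.
          even (card {f \<in> X. interlaced B e f} + of_bool (e \<in> X \<and> e \<in> twisted B)))"
        using X by (simp add: interlace_kernel_def E)
      also have "\<dots> \<longleftrightarrow> (\<forall>e\<in>U \<union> W. even (card (if e \<in> U then X \<inter> W else X \<inter> U) +
          of_bool (e \<in> X \<and> e \<in> twisted B)))"
        by (rule ball_cong[OF refl]) (simp only: nbr[OF X])
      also have "\<dots> \<longleftrightarrow>
          (\<forall>e\<in>U. even (card (X \<inter> W) + of_bool (e \<in> X \<inter> U \<and> e \<in> twisted B))) \<and>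
          (\<forall>e\<in>W. even (card (X \<inter> U) + of_bool (e \<in> X \<inter> W \<and> e \<in> twisted B)))"
        unfolding ball_Un
        by (intro arg_cong2[of _ _ _ _ "(\<and>)"] ball_cong refl) (simp_all add: not_U del: even_add)
      also have "\<dots> \<longleftrightarrow> (X \<inter> U, X \<inter> W) \<in> bipartite_kernel U W (twisted B)"
        by (simp add: bipartite_kernel_def del: even_add)
      finally show ?thesis .
    qed
    have sub: "X \<subseteq> U \<union> W" if "X \<in> interlace_kernel B" for X
      using that by (simp add: interlace_kernel_def E)
    have split: "(P \<union> Q) \<inter> U = P" "(P \<union> Q) \<inter> W = Q" "P \<union> Q \<subseteq> U \<union> W"
      if "(P, Q) \<in> bipartite_kernel U W T" for P Q T
      using that disj by (auto simp: bipartite_kernel_def)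
    show "\<forall>X\<in>interlace_kernel B. (case (X \<inter> U, X \<inter> W) of (P, Q) \<Rightarrow> P \<union> Q) = X"
      using sub by fastforce
    show "\<forall>z\<in>bipartite_kernel U W (twisted B).
        ((case z of (P, Q) \<Rightarrow> P \<union> Q) \<inter> U, (case z of (P, Q) \<Rightarrow> P \<union> Q) \<inter> W) = z"
      using split by (simp add: split_paired_all)
    show "(\<lambda>X. (X \<inter> U, X \<inter> W)) ` interlace_kernel B \<subseteq> bipartite_kernel U W (twisted B)"
      using sub ker by blast
    show "(\<lambda>(P, Q). P \<union> Q) ` bipartite_kernel U W (twisted B) \<subseteq> interlace_kernel B"
    proof clarify
      fix P Q assume PQ: "(P, Q) \<in> bipartite_kernel U W (twisted B)"
      then show "P \<union> Q \<in> interlace_kernel B" using ker[of "P \<union> Q"] split[OF PQ] by simp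
    qed
  qed
  then show ?thesis by (rule bij_betw_same_card)
qed

section \<open>Summation over the partial Petrials\<close>

lemma sum_power_card_Pow:
  fixes z :: "'a::comm_semiring_1"
  assumes "finite S"
  shows "(\<Sum>P\<in>Pow S. z ^ card P) = (1 + z) ^ card S"
  using prod_add[OF assms, of "\<lambda>_. z" "\<lambda>_. 1"] by (simp add: add.commute)

lemma sum_power_card_proper_subsets:
  fixes z :: "'a::comm_ring_1"
  assumes "finite S"
  shows "(\<Sum>P\<in>Pow S - {S}. z ^ card P) = (1 + z) ^ card S - z ^ card S"
  using assms sum_power_card_Pow[OF assms, of z] by (simp add: sum_diff1)

lemma bij_betw_symmetric_difference:
  assumes "D \<subseteq> E"
  shows "bij_betw (\<lambda>A. (D - A) \<union> (A - D)) (Pow E) (Pow E)"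
  by (rule bij_betw_byWitness[where f' = "\<lambda>A. (D - A) \<union> (A - D)"]) (use assms in auto)

lemma bij_betw_Un_Pow:
  assumes "U \<inter> W = {}"
  shows "bij_betw (\<lambda>(P, Q). P \<union> Q) (Pow U \<times> Pow W) (Pow (U \<union> W))"
  by (rule bij_betw_byWitness[where f' = "\<lambda>X. (X \<inter> U, X \<inter> W)"]) (use assms in auto)

lemma interlaced_retwist: "interlaced (B\<lparr>twisted := T\<rparr>) = interlaced B"
  by (simp add: interlaced_def fun_eq_iff)

lemma bouquet_retwist:
  assumes "bouquet B" "T \<subseteq> eribbons B"
  shows "bouquet (B\<lparr>twisted := T\<rparr>)"
proof -
  interpret bouquet B by fact
  show ?thesis
    using finite_vdiscs finite_eribbons vert_of_mem edge_of_mem two_half_edges rot_permutes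
      rot_cyclic one_vertex assms(2)
    by unfold_locales (simp_all add: half_edges_at_def)
qed

text \<open>
  The twisted set of a partial Petrial is the symmetric difference of \<open>A\<close> with a fixed set, and
  forming it permutes the sets of loops.
\<close>

lemma partial_petrial_polynomial_eq_sum_twisted:
  assumes "twisted B \<subseteq> eribbons B"
  shows "partial_petrial_polynomial B =
    (\<Sum>T\<in>Pow (eribbons B). [:0, 1:] ^ nat (euler_genus (B\<lparr>twisted := T\<rparr>)))"
  unfolding partial_petrial_polynomial_def partial_petrial_def
  using sum.reindex_bij_betw[OF bij_betw_symmetric_difference[OF assms],
      of "\<lambda>T. monom (1::int) (nat (euler_genus (B\<lparr>twisted := T\<rparr>)))"]
  by (simp add: monom_altdef)

text \<open>
  The rank is \<open>2 * i\<close> minus the nullity found in the preceding lemmas, as a function of the twisted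
  loops \<open>P\<close> and \<open>Q\<close> in the two classes.
\<close>

lemma euler_genus_bipartite:
  assumes B: "bouquet B" and E: "eribbons B = U \<union> W" and disj: "U \<inter> W = {}"
    and card: "card U = i" "card W = i" and "0 < i"
    and adj: "\<And>e f. e \<in> U \<union> W \<Longrightarrow> f \<in> U \<union> W \<Longrightarrow>
      interlaced B e f \<longleftrightarrow> (e, f) \<in> U \<times> W \<union> W \<times> U"
    and P: "P \<subseteq> U" and Q: "Q \<subseteq> W"
  shows "nat (euler_genus (B\<lparr>twisted := P \<union> Q\<rparr>)) =
    (if P = U \<and> Q = W then (if odd i then 2 * i - 1 else 2 * i)
     else if P = U then (if odd i then card Q + (i + 1) else card Q + i)
     else if Q = W then (if odd i then card P + (i + 1) else card P + i)
     else card P + card Q + 2)"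
proof -
  let ?B = "B\<lparr>twisted := P \<union> Q\<rparr>" and ?T = "P \<union> Q"
  interpret bouquet ?B using bouquet_retwist[OF B] P Q E by blast
  have fin: "finite U" "finite W" using card \<open>0 < i\<close> by (auto intro: card_ge_0_finite)
  have "card (interlace_kernel ?B) = card (bipartite_kernel U W ?T)"
    using card_interlace_kernel_bipartite[of ?B U W] E disj fin adj by (simp add: interlaced_retwist)
  moreover have "card (eribbons ?B) = 2 * i" using E disj fin card by (simp add: card_Un_disjoint)
  moreover have "eribbons ?B \<noteq> {}" using E card \<open>0 < i\<close> by auto
  ultimately have genus: "euler_genus ?B = 2 * int i - int d"
    if "card (bipartite_kernel U W ?T) = 2 ^ d" for d
    using euler_genus_eq_corank[of d] that by simp
  have diff: "U - ?T = U - P" "W - ?T = W - Q" using P Q disj by auto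
  have sub: "U \<subseteq> ?T \<longleftrightarrow> P = U" "W \<subseteq> ?T \<longleftrightarrow> Q = W" using P Q disj by auto
  have cP: "card (U - P) = i - card P" and cQ: "card (W - Q) = i - card Q"
    using P Q fin card by (simp_all add: card_Diff_subset finite_subset)
  have lP: "card P < i" if "P \<noteq> U" using that P fin card psubset_card_mono[of U P] by auto
  have lQ: "card Q < i" if "Q \<noteq> W" using that Q fin card psubset_card_mono[of W Q] by auto
  consider "P = U" "Q = W" | "P = U" "Q \<noteq> W" | "P \<noteq> U" "Q = W" | "P \<noteq> U" "Q \<noteq> W" by blast
  then show ?thesis
  proof cases
    case 1
    then have "card (bipartite_kernel U W ?T) = 2 ^ of_bool (odd i)"
      using card_bipartite_kernel_both_full[of U ?T W] sub card by simp
    from genus[OF this] show ?thesis using 1 \<open>0 < i\<close> by (auto simp: nat_eq_iff)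
  next
    case 2
    then have "card (bipartite_kernel U W ?T) = 2 ^ (if odd i then i - card Q - 1 else i - card Q)"
      using card_bipartite_kernel_one_full[of W U ?T] sub card fin diff cQ by simp
    from genus[OF this] show ?thesis using 2 lQ by (auto simp: nat_eq_iff)
  next
    case 3
    then have "card (bipartite_kernel U W ?T) = 2 ^ (if odd i then i - card P - 1 else i - card P)"
      using card_bipartite_kernel_one_full[of U W ?T] card_bipartite_kernel_swap[of U W ?T]
        sub card fin diff cP by simp
    from genus[OF this] show ?thesis using 3 lP by (auto simp: nat_eq_iff)
  next
    case 4
    then have "card (bipartite_kernel U W ?T) = 2 ^ (i - card P - 1 + (i - card Q - 1))"
      using card_bipartite_kernel_neither_full[of U W ?T] sub fin diff cP cQ by simp
    from genus[OF this] show ?thesis using 4 lP lQ by (auto simp: nat_eq_iff)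
  qed
qed

theorem corollary4p2:
  fixes B :: "('v, 'e, 'h) ribbon" and i :: nat and z :: "int poly"
  defines "z \<equiv> [:0, 1:]"
  assumes "i \<ge> 2"
    and "bouquet B"
    and "card (eribbons B) = 2 * i"
    and "K\<^bsub>i,i\<^esub> (with_proj (intersection_graph B))"
  shows "partial_petrial_polynomial B =
    (if odd i
     then z ^ (2 * i - 1) + 2 * ((1 + z) ^ i - z ^ i) * z ^ (i + 1)
            + z ^ 2 * ((1 + z) ^ i - z ^ i) ^ 2
     else z ^ (2 * i) + 2 * ((1 + z) ^ i - z ^ i) * z ^ i
            + z ^ 2 * ((1 + z) ^ i - z ^ i) ^ 2)"
proof -
  obtain U W where UW: "eribbons B = U \<union> W" "U \<inter> W = {}" "card U = i" "card W = i"
    and arcs: "parcs (intersection_graph B) = U \<times> W \<union> W \<times> U"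
    using assms(5) unfolding complete_bipartite_digraph_pair_def
    by (auto simp: intersection_graph_def)
  have adj: "interlaced B e f \<longleftrightarrow> (e, f) \<in> U \<times> W \<union> W \<times> U" if "e \<in> U \<union> W" "f \<in> U \<union> W" for e f
    using that UW(1) unfolding arcs[symmetric] by (simp add: intersection_graph_def)
  have "0 < i" using assms(2) by simp
  have fin: "finite U" "finite W" using UW \<open>0 < i\<close> by (auto intro: card_ge_0_finite)
  have tw: "twisted B \<subseteq> eribbons B"
    using assms(3) by (simp add: bouquet_def ribbon_graph.twisted_subset)
  define u where "u = (if odd i then i + 1 else i)"
  define both where "both = (if odd i then 2 * i - 1 else 2 * i)"
  define \<gamma> where "\<gamma> P Q = nat (euler_genus (B\<lparr>twisted := P \<union> Q\<rparr>))" for P Q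
  note genus = euler_genus_bipartite[OF assms(3) UW \<open>0 < i\<close> adj, folded \<gamma>_def]
  define s where "s = (1 + z) ^ i - z ^ i"
  have proper: "(\<Sum>P\<in>Pow U - {U}. z ^ card P) = s" "(\<Sum>Q\<in>Pow W - {W}. z ^ card Q) = s"
    using sum_power_card_proper_subsets[of U z] sum_power_card_proper_subsets[of W z] fin UW
    by (simp_all add: s_def)
  have g: "\<gamma> U W = both"
    "\<And>Q. Q \<in> Pow W - {W} \<Longrightarrow> \<gamma> U Q = card Q + u"
    "\<And>P. P \<in> Pow U - {U} \<Longrightarrow> \<gamma> P W = card P + u"
    "\<And>P Q. P \<in> Pow U - {U} \<Longrightarrow> Q \<in> Pow W - {W} \<Longrightarrow> \<gamma> P Q = card P + card Q + 2"
    using genus by (auto simp: u_def both_def)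
  \<comment> \<open>The genus depends on whether a class is twisted as a whole, hence the term of the
    full class is split off in both sums.\<close>
  have split: "sum h (Pow S) = h S + sum h (Pow S - {S})"
    if "finite S" for h :: "'e set \<Rightarrow> int poly" and S
    using that by (intro sum.remove) auto
  have "partial_petrial_polynomial B = (\<Sum>(P, Q)\<in>Pow U \<times> Pow W. z ^ \<gamma> P Q)"
    using sum.reindex_bij_betw[OF bij_betw_Un_Pow[OF UW(2)],
        of "\<lambda>T. z ^ nat (euler_genus (B\<lparr>twisted := T\<rparr>))"]
    by (simp add: partial_petrial_polynomial_eq_sum_twisted[OF tw] UW(1) z_def \<gamma>_def case_prod_unfold)
  also have "\<dots> = (\<Sum>P\<in>Pow U. \<Sum>Q\<in>Pow W. z ^ \<gamma> P Q)"
    by (simp add: sum.cartesian_product)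
  also have "\<dots> = z ^ \<gamma> U W + (\<Sum>Q\<in>Pow W - {W}. z ^ \<gamma> U Q) +
      ((\<Sum>P\<in>Pow U - {U}. z ^ \<gamma> P W) + (\<Sum>P\<in>Pow U - {U}. \<Sum>Q\<in>Pow W - {W}. z ^ \<gamma> P Q))"
    by (simp add: split[OF fin(1)] split[OF fin(2)] sum.distrib)
  also have "\<dots> = z ^ both + (\<Sum>Q\<in>Pow W - {W}. z ^ card Q * z ^ u) +
      ((\<Sum>P\<in>Pow U - {U}. z ^ card P * z ^ u) +
       (\<Sum>P\<in>Pow U - {U}. \<Sum>Q\<in>Pow W - {W}. z ^ card P * z ^ card Q * z ^ 2))"
    by (intro arg_cong2[of _ _ _ _ "(+)"] sum.cong refl) (simp_all only: g power_add)
  also have "\<dots> = z ^ both + s * z ^ u + (s * z ^ u + s * s * z ^ 2)"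
    by (simp add: proper flip: sum_distrib_left sum_distrib_right)
  also have "\<dots> = z ^ both + 2 * s * z ^ u + z ^ 2 * s ^ 2"
    by (simp add: algebra_simps power2_eq_square)
  finally show ?thesis by (simp add: u_def both_def s_def)
qed

end
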